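(* Let $(L,\cdot,[,],\alpha,\beta)$ be a regular strong BiHom-Poisson algebra over $K$ and $D:L\to L$ a derivation of both $(L,\cdot,\alpha,\beta)$ and $(L,[,],\alpha,\beta)$ such that any two of the maps $\alpha,\beta,D$ commute. Define a ternary operation on $L$ by $$[x,y,z]=D(x)\cdot[\beta^{-1}(y),\beta^{-1}(z)]+D(y)\cdot[\alpha^{-1}(z),\alpha\beta^{-2}(x)]+D\alpha^{-1}\beta(z)\cdot[\beta^{-1}(x),\alpha\beta^{-2}(y)].$$ Then $(L,\cdot,[\ ,\ ,\ ],\alpha,\beta)$ is a strong BiHom-Poisson 3-Lie algebra.
   Context: $K$ is a field of characteristic $0$; all vector spaces and linear maps are over $K$. A BiHom-commutative algebra $(L,\cdot,\alpha,\beta)$ is a vector space $L$ with a bilinear product $\cdot$ and linear maps $\alpha,\beta:L\to L$ such that for all $x,y,z$: $\alpha\circ\beta=\beta\circ\alpha$, $\alpha(x\cdot y)=\alpha(x)\cdot\alpha(y)$, $\beta(x\cdot y)=\beta(x)\cdot\beta(y)$, $\alpha(x)\cdot(y\cdot z)=(x\cdot y)\cdot\beta(z)$, and $\beta(x)\cdot\alpha(y)=\beta(y)\cdot\alpha(x)$. A BiHom-Lie algebra $(L,[,],\alpha,\beta)$ is a vector space $L$ with a bilinear bracket and commuting linear maps $\alpha,\beta:L\to L$ such that for all $x,y,z$: $\alpha([x,y])=[\alpha(x),\alpha(y)]$, $\beta([x,y])=[\beta(x),\beta(y)]$, $[\beta(x),\alpha(y)]=-[\beta(y),\alpha(x)]$,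 and $[[\beta(x),\alpha(y)],\alpha^2(z)]+[[\beta(y),\alpha(z)],\alpha^2(x)]+[[\beta(z),\alpha(x)],\alpha^2(y)]=0$. A BiHom-Poisson algebra is a 5-tuple $(L,\cdot,[,],\alpha,\beta)$ such that $(L,\cdot,\alpha,\beta)$ is a BiHom-commutative algebra, $(L,[,],\alpha,\beta)$ is a BiHom-Lie algebra, and for all $x,y,z$: $[\alpha\beta(x),y\cdot z]=[\beta(x),y]\cdot\beta(z)+\beta(y)\cdot[\alpha(x),z]$. It is regular if $\alpha,\beta$ are invertible, and strong if for all $x,y,z,h\in L$ the sum over cyclic permutations of $x,y,z$ of $[\alpha\beta^{3}(x),\alpha^{2}\beta^{2}(y)]\cdot[\alpha^{2}\beta(h),\alpha^{3}\beta(z)]$ is $0$. $D$ is a derivation of $(L,\cdot,\alpha,\beta)$ and of $(L,[,],\alpha,\beta)$ if it is linear with $D(x\cdot y)=D(x)\cdot y+x\cdot D(y)$ and $D([x,y])=[D(x),y]+[x,D(y)]$. A 3-BiHom-Lie algebra $(L,[\ ,\ ,\ ],\alpha,\beta)$ is a vector space $L$ with commuting linear maps $\alpha,\beta:L\to L$ and a trilinear map $[\ ,\ ,\ ]$ such that for all $x,y,z,u,v\in L$: (i) $\alpha([x,y,z])=[\alpha(x),\alpha(y),\alpha(z)]$ and $\beta([x,y,z])=[\beta(x),\beta(y),\beta(z)]$; (ii) $[\beta(x),\beta(y),\alpha(z)]=-[\beta(y),\beta(x),\alpha(z)]=-[\beta(x),\beta(z),\alpha(y)]$; (iii) $[\beta^2(u),\beta^2(v),[\beta(x),\beta(y),\alpha(z)]]=[\beta^2(y),\beta^2(z),[\beta(u),\beta(v),\alpha(x)]]-[\beta^2(x),\beta^2(z),[\beta(u),\beta(v),\alpha(y)]]+[\beta^2(x),\beta^2(y),[\beta(u),\beta(v),\alpha(z)]]$.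 A BiHom-Poisson 3-Lie algebra is a 5-tuple $(L,\cdot,[\ ,\ ,\ ],\alpha,\beta)$ where $(L,\cdot,\alpha,\beta)$ is a BiHom-commutative algebra, $(L,[\ ,\ ,\ ],\alpha,\beta)$ is a 3-BiHom-Lie algebra, and $[\alpha\beta(x),\alpha\beta(y),u\cdot v]=[\beta(x),\beta(y),u]\cdot\beta(v)+\beta(u)\cdot[\alpha(x),\alpha(y),v]$ for all $x,y,u,v$. It is strong if for all $x,y,z,u,v,w\in L$: $0=[\beta^2(x),\beta^2(y),\alpha\beta(u)]\cdot[\alpha\beta(z),\alpha\beta(v),\alpha^2(w)]-[\beta^2(x),\beta^2(y),\alpha\beta(z)]\cdot[\alpha\beta(u),\alpha\beta(v),\alpha^2(w)]+[\beta^2(x),\beta^2(y),\alpha\beta(w)]\cdot[\alpha\beta(z),\alpha\beta(u),\alpha^2(v)]-[\beta^2(x),\beta^2(y),\alpha\beta(v)]\cdot[\alpha\beta(z),\alpha\beta(u),\alpha^2(w)]$. *)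

theory Defs
  imports Complex_Main
begin

text \<open>
  A vector space over a field of characteristic 0 is a type \<open>'v\<close> with an addition and a
  scalar multiplication \<open>scale\<close> over \<open>'k :: field_char_0\<close> (the library locale
  \<^locale>\<open>vector_space\<close>); the carrier is the whole type.
\<close>

definition bilinear_map ::
  "('k::field_char_0 \<Rightarrow> 'v::ab_group_add \<Rightarrow> 'v) \<Rightarrow> ('v \<Rightarrow> 'v \<Rightarrow> 'v) \<Rightarrow> bool" where
  "bilinear_map scale f \<longleftrightarrow>
     (\<forall>y. Vector_Spaces.linear scale scale (\<lambda>x. f x y)) \<and>
     (\<forall>x. Vector_Spaces.linear scale scale (\<lambda>y. f x y))"

definition trilinear_map ::
  "('k::field_char_0 \<Rightarrow> 'v::ab_group_add \<Rightarrow> 'v) \<Rightarrow> ('v \<Rightarrow> 'v \<Rightarrow> 'v \<Rightarrow> 'v) \<Rightarrow> bool" where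
  "trilinear_map scale f \<longleftrightarrow>
     (\<forall>y z. Vector_Spaces.linear scale scale (\<lambda>x. f x y z)) \<and>
     (\<forall>x z. Vector_Spaces.linear scale scale (\<lambda>y. f x y z)) \<and>
     (\<forall>x y. Vector_Spaces.linear scale scale (\<lambda>z. f x y z))"

locale bihom_space = vector_space scale
  for scale :: "'k::field_char_0 \<Rightarrow> 'v::ab_group_add \<Rightarrow> 'v" +
  fixes \<alpha> \<beta> :: "'v \<Rightarrow> 'v"
  assumes linear_alpha: "Vector_Spaces.linear scale scale \<alpha>"
    and linear_beta: "Vector_Spaces.linear scale scale \<beta>"
    and alpha_beta_commute: "\<alpha> \<circ> \<beta> = \<beta> \<circ> \<alpha>"

locale bihom_commutative_algebra = bihom_space scale \<alpha> \<beta>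
  for scale :: "'k::field_char_0 \<Rightarrow> 'v::ab_group_add \<Rightarrow> 'v"
    and mult :: "'v \<Rightarrow> 'v \<Rightarrow> 'v" (infixl "\<cdot>" 70)
    and \<alpha> \<beta> :: "'v \<Rightarrow> 'v" +
  assumes mult_bilinear: "bilinear_map scale (\<cdot>)"
    and alpha_mult: "\<alpha> (x \<cdot> y) = \<alpha> x \<cdot> \<alpha> y"
    and beta_mult: "\<beta> (x \<cdot> y) = \<beta> x \<cdot> \<beta> y"
    and bihom_assoc: "\<alpha> x \<cdot> (y \<cdot> z) = (x \<cdot> y) \<cdot> \<beta> z"
    and bihom_comm: "\<beta> x \<cdot> \<alpha> y = \<beta> y \<cdot> \<alpha> x"

locale bihom_lie_algebra = bihom_space scale \<alpha> \<beta>
  for scale :: "'k::field_char_0 \<Rightarrow> 'v::ab_group_add \<Rightarrow> 'v"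
    and br :: "'v \<Rightarrow> 'v \<Rightarrow> 'v"
    and \<alpha> \<beta> :: "'v \<Rightarrow> 'v" +
  assumes br_bilinear: "bilinear_map scale br"
    and alpha_br: "\<alpha> (br x y) = br (\<alpha> x) (\<alpha> y)"
    and beta_br: "\<beta> (br x y) = br (\<beta> x) (\<beta> y)"
    and bihom_skew: "br (\<beta> x) (\<alpha> y) = - br (\<beta> y) (\<alpha> x)"
    and bihom_jacobi:
      "br (br (\<beta> x) (\<alpha> y)) ((\<alpha> ^^ 2) z) + br (br (\<beta> y) (\<alpha> z)) ((\<alpha> ^^ 2) x)
        + br (br (\<beta> z) (\<alpha> x)) ((\<alpha> ^^ 2) y) = 0"

locale bihom_poisson_algebra =
  bihom_commutative_algebra scale mult \<alpha> \<beta> + bihom_lie_algebra scale br \<alpha> \<beta>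
  for scale :: "'k::field_char_0 \<Rightarrow> 'v::ab_group_add \<Rightarrow> 'v"
    and mult :: "'v \<Rightarrow> 'v \<Rightarrow> 'v" (infixl "\<cdot>" 70)
    and br :: "'v \<Rightarrow> 'v \<Rightarrow> 'v"
    and \<alpha> \<beta> :: "'v \<Rightarrow> 'v" +
  assumes bihom_leibniz:
    "br (\<alpha> (\<beta> x)) (y \<cdot> z) = br (\<beta> x) y \<cdot> \<beta> z + \<beta> y \<cdot> br (\<alpha> x) z"

locale regular_bihom_poisson_algebra = bihom_poisson_algebra scale mult br \<alpha> \<beta>
  for scale :: "'k::field_char_0 \<Rightarrow> 'v::ab_group_add \<Rightarrow> 'v"
    and mult :: "'v \<Rightarrow> 'v \<Rightarrow> 'v" (infixl "\<cdot>" 70)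
    and br :: "'v \<Rightarrow> 'v \<Rightarrow> 'v"
    and \<alpha> \<beta> :: "'v \<Rightarrow> 'v" +
  assumes bij_alpha: "bij \<alpha>"
    and bij_beta: "bij \<beta>"

locale strong_bihom_poisson_algebra = bihom_poisson_algebra scale mult br \<alpha> \<beta>
  for scale :: "'k::field_char_0 \<Rightarrow> 'v::ab_group_add \<Rightarrow> 'v"
    and mult :: "'v \<Rightarrow> 'v \<Rightarrow> 'v" (infixl "\<cdot>" 70)
    and br :: "'v \<Rightarrow> 'v \<Rightarrow> 'v"
    and \<alpha> \<beta> :: "'v \<Rightarrow> 'v" +
  assumes strong:
    "br (\<alpha> ((\<beta> ^^ 3) x)) ((\<alpha> ^^ 2) ((\<beta> ^^ 2) y)) \<cdot> br ((\<alpha> ^^ 2) (\<beta> h)) ((\<alpha> ^^ 3) (\<beta> z))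
   + br (\<alpha> ((\<beta> ^^ 3) y)) ((\<alpha> ^^ 2) ((\<beta> ^^ 2) z)) \<cdot> br ((\<alpha> ^^ 2) (\<beta> h)) ((\<alpha> ^^ 3) (\<beta> x))
   + br (\<alpha> ((\<beta> ^^ 3) z)) ((\<alpha> ^^ 2) ((\<beta> ^^ 2) x)) \<cdot> br ((\<alpha> ^^ 2) (\<beta> h)) ((\<alpha> ^^ 3) (\<beta> y)) = 0"

definition derivation ::
  "('k::field_char_0 \<Rightarrow> 'v::ab_group_add \<Rightarrow> 'v) \<Rightarrow> ('v \<Rightarrow> 'v \<Rightarrow> 'v) \<Rightarrow> ('v \<Rightarrow> 'v) \<Rightarrow> bool" where
  "derivation scale f D \<longleftrightarrow>
     Vector_Spaces.linear scale scale D \<and> (\<forall>x y. D (f x y) = f (D x) y + f x (D y))"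

locale three_bihom_lie_algebra = bihom_space scale \<alpha> \<beta>
  for scale :: "'k::field_char_0 \<Rightarrow> 'v::ab_group_add \<Rightarrow> 'v"
    and tbr :: "'v \<Rightarrow> 'v \<Rightarrow> 'v \<Rightarrow> 'v"
    and \<alpha> \<beta> :: "'v \<Rightarrow> 'v" +
  assumes tbr_trilinear: "trilinear_map scale tbr"
    and alpha_tbr: "\<alpha> (tbr x y z) = tbr (\<alpha> x) (\<alpha> y) (\<alpha> z)"
    and beta_tbr: "\<beta> (tbr x y z) = tbr (\<beta> x) (\<beta> y) (\<beta> z)"
    and three_bihom_skew_12: "tbr (\<beta> x) (\<beta> y) (\<alpha> z) = - tbr (\<beta> y) (\<beta> x) (\<alpha> z)"
    and three_bihom_skew_23: "tbr (\<beta> x) (\<beta> y) (\<alpha> z) = - tbr (\<beta> x) (\<beta> z) (\<alpha> y)"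
    and three_bihom_jacobi:
      "tbr ((\<beta> ^^ 2) u) ((\<beta> ^^ 2) v) (tbr (\<beta> x) (\<beta> y) (\<alpha> z))
         = tbr ((\<beta> ^^ 2) y) ((\<beta> ^^ 2) z) (tbr (\<beta> u) (\<beta> v) (\<alpha> x))
         - tbr ((\<beta> ^^ 2) x) ((\<beta> ^^ 2) z) (tbr (\<beta> u) (\<beta> v) (\<alpha> y))
         + tbr ((\<beta> ^^ 2) x) ((\<beta> ^^ 2) y) (tbr (\<beta> u) (\<beta> v) (\<alpha> z))"

locale bihom_poisson_three_lie_algebra =
  bihom_commutative_algebra scale mult \<alpha> \<beta> + three_bihom_lie_algebra scale tbr \<alpha> \<beta>
  for scale :: "'k::field_char_0 \<Rightarrow> 'v::ab_group_add \<Rightarrow> 'v"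
    and mult :: "'v \<Rightarrow> 'v \<Rightarrow> 'v" (infixl "\<cdot>" 70)
    and tbr :: "'v \<Rightarrow> 'v \<Rightarrow> 'v \<Rightarrow> 'v"
    and \<alpha> \<beta> :: "'v \<Rightarrow> 'v" +
  assumes three_bihom_leibniz:
    "tbr (\<alpha> (\<beta> x)) (\<alpha> (\<beta> y)) (u \<cdot> v)
       = tbr (\<beta> x) (\<beta> y) u \<cdot> \<beta> v + \<beta> u \<cdot> tbr (\<alpha> x) (\<alpha> y) v"

locale strong_bihom_poisson_three_lie_algebra =
  bihom_poisson_three_lie_algebra scale mult tbr \<alpha> \<beta>
  for scale :: "'k::field_char_0 \<Rightarrow> 'v::ab_group_add \<Rightarrow> 'v"
    and mult :: "'v \<Rightarrow> 'v \<Rightarrow> 'v" (infixl "\<cdot>" 70)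
    and tbr :: "'v \<Rightarrow> 'v \<Rightarrow> 'v \<Rightarrow> 'v"
    and \<alpha> \<beta> :: "'v \<Rightarrow> 'v" +
  assumes three_strong:
    "0 = tbr ((\<beta> ^^ 2) x) ((\<beta> ^^ 2) y) (\<alpha> (\<beta> u)) \<cdot> tbr (\<alpha> (\<beta> z)) (\<alpha> (\<beta> v)) ((\<alpha> ^^ 2) w)
       - tbr ((\<beta> ^^ 2) x) ((\<beta> ^^ 2) y) (\<alpha> (\<beta> z)) \<cdot> tbr (\<alpha> (\<beta> u)) (\<alpha> (\<beta> v)) ((\<alpha> ^^ 2) w)
       + tbr ((\<beta> ^^ 2) x) ((\<beta> ^^ 2) y) (\<alpha> (\<beta> w)) \<cdot> tbr (\<alpha> (\<beta> z)) (\<alpha> (\<beta> u)) ((\<alpha> ^^ 2) v)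
       - tbr ((\<beta> ^^ 2) x) ((\<beta> ^^ 2) y) (\<alpha> (\<beta> v)) \<cdot> tbr (\<alpha> (\<beta> z)) (\<alpha> (\<beta> u)) ((\<alpha> ^^ 2) w)"

text \<open>
  The inverses are given by \<^const>\<open>inv\<close>, so this is the intended operation only for
  bijective \<open>\<alpha>\<close> and \<open>\<beta>\<close>.
\<close>

definition ternary_bracket ::
  "('v::ab_group_add \<Rightarrow> 'v \<Rightarrow> 'v) \<Rightarrow> ('v \<Rightarrow> 'v \<Rightarrow> 'v) \<Rightarrow> ('v \<Rightarrow> 'v) \<Rightarrow> ('v \<Rightarrow> 'v) \<Rightarrow> ('v \<Rightarrow> 'v)
    \<Rightarrow> 'v \<Rightarrow> 'v \<Rightarrow> 'v \<Rightarrow> 'v" where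
  "ternary_bracket mult br \<alpha> \<beta> D x y z =
     mult (D x) (br (inv \<beta> y) (inv \<beta> z))
   + mult (D y) (br (inv \<alpha> z) (\<alpha> ((inv \<beta> ^^ 2) x)))
   + mult (D (inv \<alpha> (\<beta> z))) (br (inv \<beta> x) (\<alpha> ((inv \<beta> ^^ 2) y)))"

end

theory Submission
  imports Defs
begin

text \<open>
  A regular BiHom-Poisson algebra is an ordinary Poisson algebra in disguise. The products
  \<open>x \<odot> y = \<alpha>\<^sup>-\<^sup>1 x \<cdot> \<beta>\<^sup>-\<^sup>1 y\<close> and \<open>\<lbrace>x, y\<rbrace> = [\<alpha>\<^sup>-\<^sup>1 x, \<beta>\<^sup>-\<^sup>1 y]\<close> form a Poisson
  algebra of which \<open>\<alpha>\<close> and \<open>\<beta>\<close> are commuting automorphisms; the original operations are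
  recovered as \<open>x \<cdot> y = \<alpha> x \<odot> \<beta> y\<close> and \<open>[x, y] = \<lbrace>\<alpha> x, \<beta> y\<rbrace>\<close>. Every BiHom identity becomes the
  ordinary identity in which all twists have been moved onto the variables, where bijectivity
  absorbs them. The strong condition becomes the Pluecker relation
  \<open>\<lbrace>h, x\<rbrace> \<odot> \<lbrace>y, z\<rbrace> + \<lbrace>h, y\<rbrace> \<odot> \<lbrace>z, x\<rbrace> + \<lbrace>h, z\<rbrace> \<odot> \<lbrace>x, y\<rbrace> = 0\<close>, \<open>D\<close> remains a derivation, and the
  ternary operation is \<open>[x, y, z] = t (\<alpha> x) (\<alpha> y) (\<beta> z)\<close> for the untwisted bracket
  \<open>t x y z = D x \<odot> \<lbrace>y, z\<rbrace> + D y \<odot> \<lbrace>z, x\<rbrace> + D z \<odot> \<lbrace>x, y\<rbrace>\<close>, called \<open>nambu\<close> below.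

  This leaves an ordinary theorem about \<open>t\<close>. Formally \<open>t x y z\<close> is a \<open>3 \<times> 3\<close> determinant with one
  row of values of \<open>D\<close>, expanded along that row, with the bracket in the place of the \<open>2 \<times> 2\<close>
  minors; the Pluecker relation says that the bracket behaves like such minors. Hence \<open>t\<close>
  satisfies the Pluecker relation of \<open>3 \<times> 3\<close> minors (\<open>nambu_pluecker\<close>), which is the strong
  condition for ternary brackets.

  The fundamental identity says that \<open>d = t u v\<close> is a derivation of \<open>t\<close>. It is a derivation of
  the product, so the failure of \<open>d\<close> to respect \<open>t\<close> comes from its commutator with \<open>D\<close>
  (\<open>D_nambu_commutator\<close>) and from its failure to respect the bracket (\<open>nambu_bkt_defect\<close>).
  Both contain a multiple of \<open>D \<lbrace>u, v\<rbrace>\<close>, with opposite signs; the remaining terms vanish after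
  summing cyclically, some by the Pluecker relation and the others by telescoping
  (\<open>nambu_derivation\<close>).
\<close>

section \<open>Strong Poisson algebras with a derivation\<close>

locale strong_poisson_derivation =
  fixes prd :: "'v::ab_group_add \<Rightarrow> 'v \<Rightarrow> 'v" (infixl "\<odot>" 70)
    and bkt :: "'v \<Rightarrow> 'v \<Rightarrow> 'v" ("\<lbrace>_, _\<rbrace>")
    and D :: "'v \<Rightarrow> 'v"
  assumes prd_add_left: "(x + y) \<odot> z = x \<odot> z + y \<odot> z"
    and prd_commute: "x \<odot> y = y \<odot> x"
    and prd_assoc: "(x \<odot> y) \<odot> z = x \<odot> (y \<odot> z)"
    and bkt_add_left: "\<lbrace>x + y, z\<rbrace> = \<lbrace>x, z\<rbrace> + \<lbrace>y, z\<rbrace>"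
    and bkt_skew: "\<lbrace>x, y\<rbrace> = - \<lbrace>y, x\<rbrace>"
    and jacobi: "\<lbrace>\<lbrace>x, y\<rbrace>, z\<rbrace> + \<lbrace>\<lbrace>y, z\<rbrace>, x\<rbrace> + \<lbrace>\<lbrace>z, x\<rbrace>, y\<rbrace> = 0"
    and leibniz: "\<lbrace>x, y \<odot> z\<rbrace> = \<lbrace>x, y\<rbrace> \<odot> z + y \<odot> \<lbrace>x, z\<rbrace>"
    and pluecker: "\<lbrace>x, y\<rbrace> \<odot> \<lbrace>h, z\<rbrace> + \<lbrace>y, z\<rbrace> \<odot> \<lbrace>h, x\<rbrace> + \<lbrace>z, x\<rbrace> \<odot> \<lbrace>h, y\<rbrace> = 0"
    and D_add: "D (x + y) = D x + D y"
    and D_prd: "D (x \<odot> y) = D x \<odot> y + x \<odot> D y"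
    and D_bkt: "D \<lbrace>x, y\<rbrace> = \<lbrace>D x, y\<rbrace> + \<lbrace>x, D y\<rbrace>"
begin

sublocale prd: abel_semigroup prd
  by unfold_locales (rule prd_assoc, rule prd_commute)

lemma prd_add_right: "x \<odot> (y + z) = x \<odot> y + x \<odot> z"
  by (metis prd_add_left prd_commute)

lemma bkt_add_right: "\<lbrace>x, y + z\<rbrace> = \<lbrace>x, y\<rbrace> + \<lbrace>x, z\<rbrace>"
  by (metis bkt_add_left bkt_skew minus_add_distrib)

lemma prd_zero_left [simp]: "0 \<odot> x = 0"
  using prd_add_left [of 0 0 x] by simp

lemma prd_zero_right [simp]: "x \<odot> 0 = 0"
  using prd_add_right [of x 0 0] by simp

lemma bkt_zero_left [simp]: "\<lbrace>0, x\<rbrace> = 0"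
  using bkt_add_left [of 0 0 x] by simp

lemma D_zero [simp]: "D 0 = 0"
  using D_add [of 0 0] by simp

lemma prd_minus_left [simp]: "(- x) \<odot> y = - (x \<odot> y)"
  using prd_add_left [of x "- x" y] by (simp add: eq_neg_iff_add_eq_0 add.commute)

lemma prd_minus_right [simp]: "x \<odot> (- y) = - (x \<odot> y)"
  by (metis prd_minus_left prd_commute)

lemma bkt_minus_left [simp]: "\<lbrace>- x, y\<rbrace> = - \<lbrace>x, y\<rbrace>"
  using bkt_add_left [of x "- x" y] by (simp add: eq_neg_iff_add_eq_0 add.commute)

lemma bkt_minus_right [simp]: "\<lbrace>x, - y\<rbrace> = - \<lbrace>x, y\<rbrace>"
  by (metis bkt_minus_left bkt_skew)

lemma D_minus [simp]: "D (- x) = - D x"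
  using D_add [of x "- x"] by (simp add: eq_neg_iff_add_eq_0 add.commute)

lemma prd_diff_left: "(x - y) \<odot> z = x \<odot> z - y \<odot> z"
  using prd_add_left [of x "- y" z] by simp

lemma prd_diff_right: "x \<odot> (y - z) = x \<odot> y - x \<odot> z"
  using prd_add_right [of x y "- z"] by simp

lemma bkt_diff_left: "\<lbrace>x - y, z\<rbrace> = \<lbrace>x, z\<rbrace> - \<lbrace>y, z\<rbrace>"
  using bkt_add_left [of x "- y" z] by simp

lemma bkt_diff_right: "\<lbrace>x, y - z\<rbrace> = \<lbrace>x, y\<rbrace> - \<lbrace>x, z\<rbrace>"
  using bkt_add_right [of x y "- z"] by simp

lemma D_diff: "D (x - y) = D x - D y"
  using D_add [of x "- y"] by simp

lemmas expand =
  prd_add_left prd_add_right prd_diff_left prd_diff_right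
  bkt_add_left bkt_add_right bkt_diff_left bkt_diff_right D_add D_diff

lemma leibniz_left: "\<lbrace>y \<odot> z, x\<rbrace> = \<lbrace>y, x\<rbrace> \<odot> z + y \<odot> \<lbrace>z, x\<rbrace>"
  using leibniz [of x y z] bkt_skew [of x "y \<odot> z"] bkt_skew [of x y] bkt_skew [of x z]
  by (simp add: minus_equation_iff [of "\<lbrace>y \<odot> z, x\<rbrace>"] add.commute)

lemma jacobi_derivation: "\<lbrace>x, \<lbrace>y, z\<rbrace>\<rbrace> = \<lbrace>\<lbrace>x, y\<rbrace>, z\<rbrace> + \<lbrace>y, \<lbrace>x, z\<rbrace>\<rbrace>"
proof -
  have "\<lbrace>x, \<lbrace>y, z\<rbrace>\<rbrace> = - \<lbrace>\<lbrace>y, z\<rbrace>, x\<rbrace>"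
    by (rule bkt_skew)
  moreover have "\<lbrace>y, \<lbrace>x, z\<rbrace>\<rbrace> = \<lbrace>\<lbrace>z, x\<rbrace>, y\<rbrace>"
    using bkt_skew [of y "\<lbrace>x, z\<rbrace>"] bkt_skew [of x z] by simp
  ultimately show ?thesis
    using jacobi [of x y z] by (simp add: neg_eq_iff_add_eq_0 ac_simps)
qed

lemma pluecker_cyclic: "\<lbrace>h, x\<rbrace> \<odot> \<lbrace>y, z\<rbrace> + \<lbrace>h, y\<rbrace> \<odot> \<lbrace>z, x\<rbrace> + \<lbrace>h, z\<rbrace> \<odot> \<lbrace>x, y\<rbrace> = 0"
  using pluecker [of x y h z] by (simp add: ac_simps)

text \<open>
  The Pluecker relation solved for one product, in which the entry \<open>v\<close> is exchanged with
  \<open>y\<close> and \<open>z\<close> in turn.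
\<close>

lemma pluecker_left: "\<lbrace>a, v\<rbrace> \<odot> \<lbrace>y, z\<rbrace> = \<lbrace>a, y\<rbrace> \<odot> \<lbrace>v, z\<rbrace> - \<lbrace>a, z\<rbrace> \<odot> \<lbrace>v, y\<rbrace>"
  using pluecker [of y z a v] bkt_skew [of z v]
  by (simp add: prd_commute add_eq_0_iff algebra_simps)

section \<open>The ternary bracket of a derivation\<close>

definition nambu :: "'v \<Rightarrow> 'v \<Rightarrow> 'v \<Rightarrow> 'v" where
  "nambu x y z = D x \<odot> \<lbrace>y, z\<rbrace> + D y \<odot> \<lbrace>z, x\<rbrace> + D z \<odot> \<lbrace>x, y\<rbrace>"

lemma nambu_swap_12: "nambu x y z = - nambu y x z"
  using bkt_skew [of x z] bkt_skew [of y z] bkt_skew [of x y]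
  by (simp add: nambu_def algebra_simps)

lemma nambu_swap_23: "nambu x y z = - nambu x z y"
  using bkt_skew [of x z] bkt_skew [of y z] bkt_skew [of x y]
  by (simp add: nambu_def algebra_simps)

lemma nambu_rotate: "nambu x y z = nambu y z x"
  by (simp add: nambu_def algebra_simps)

text \<open>
  Each of \<open>D\<close>, \<open>\<lbrace>u, -\<rbrace>\<close> and \<open>\<lbrace>v, -\<rbrace>\<close> is a derivation of the commutative product, and
  \<open>nambu u v\<close> is a combination of them with coefficients in the algebra.
\<close>

lemma nambu_prd: "nambu u v (x \<odot> y) = nambu u v x \<odot> y + x \<odot> nambu u v y"
  by (simp add: nambu_def expand D_prd leibniz leibniz_left ac_simps)

lemma nambu_add: "nambu u v (x + y) = nambu u v x + nambu u v y"
  by (simp add: nambu_def expand ac_simps)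

text \<open>
  The commutator of \<open>D\<close> with \<open>nambu u v\<close> only differentiates the coefficients
  \<open>D u\<close>, \<open>D v\<close>, \<open>\<lbrace>u, v\<rbrace>\<close> and the entries \<open>u\<close>, \<open>v\<close> of the brackets.
\<close>

lemma D_nambu_commutator:
  "D (nambu u v x) = nambu u v (D x)
    + D (D u) \<odot> \<lbrace>v, x\<rbrace> - D (D v) \<odot> \<lbrace>u, x\<rbrace>
    + D u \<odot> \<lbrace>D v, x\<rbrace> - D v \<odot> \<lbrace>D u, x\<rbrace> + D x \<odot> D \<lbrace>u, v\<rbrace>"
  using bkt_skew [of "x" u] bkt_skew [of x "D u"] bkt_skew [of "D x" u]
  by (simp add: nambu_def expand D_prd D_bkt algebra_simps)

text \<open>
  If \<open>\<delta>\<close> is a derivation of the bracket, then \<open>a \<odot> \<delta>\<close> fails to be one by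
  \<open>\<lbrace>a, z\<rbrace> \<odot> \<delta> y + \<lbrace>y, a\<rbrace> \<odot> \<delta> z\<close>. For the coefficients \<open>D u\<close> and \<open>D v\<close> of \<open>nambu u v\<close> these
  terms add up, by the Pluecker relation, to the single multiple of \<open>D \<lbrace>u, v\<rbrace>\<close>; the
  coefficient \<open>\<lbrace>u, v\<rbrace>\<close> gives the two terms after it.
\<close>

lemma nambu_bkt_defect:
  "nambu u v \<lbrace>y, z\<rbrace> = \<lbrace>nambu u v y, z\<rbrace> + \<lbrace>y, nambu u v z\<rbrace>
    + D \<lbrace>u, v\<rbrace> \<odot> \<lbrace>y, z\<rbrace> - D y \<odot> \<lbrace>\<lbrace>u, v\<rbrace>, z\<rbrace> + D z \<odot> \<lbrace>\<lbrace>u, v\<rbrace>, y\<rbrace>"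
proof -
  have form: "nambu u v x = D u \<odot> \<lbrace>v, x\<rbrace> - D v \<odot> \<lbrace>u, x\<rbrace> + D x \<odot> \<lbrace>u, v\<rbrace>" for x
    using bkt_skew [of x u] by (simp add: nambu_def)
  have 1: "D \<lbrace>u, v\<rbrace> \<odot> \<lbrace>y, z\<rbrace> =
      \<lbrace>D u, y\<rbrace> \<odot> \<lbrace>v, z\<rbrace> - \<lbrace>D u, z\<rbrace> \<odot> \<lbrace>v, y\<rbrace> - \<lbrace>D v, y\<rbrace> \<odot> \<lbrace>u, z\<rbrace> + \<lbrace>D v, z\<rbrace> \<odot> \<lbrace>u, y\<rbrace>"
    using bkt_skew [of u "D v"]
    by (simp add: D_bkt expand pluecker_left [of "D u" v] pluecker_left [of "D v" u] algebra_simps)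
  have 2: "\<lbrace>nambu u v y, z\<rbrace> =
      D u \<odot> \<lbrace>\<lbrace>v, y\<rbrace>, z\<rbrace> + \<lbrace>D u, z\<rbrace> \<odot> \<lbrace>v, y\<rbrace> - D v \<odot> \<lbrace>\<lbrace>u, y\<rbrace>, z\<rbrace> - \<lbrace>D v, z\<rbrace> \<odot> \<lbrace>u, y\<rbrace>
      + \<lbrace>D y, z\<rbrace> \<odot> \<lbrace>u, v\<rbrace> + D y \<odot> \<lbrace>\<lbrace>u, v\<rbrace>, z\<rbrace>"
    by (simp add: form expand leibniz_left algebra_simps)
  have 3: "\<lbrace>y, nambu u v z\<rbrace> =
      D u \<odot> \<lbrace>y, \<lbrace>v, z\<rbrace>\<rbrace> - \<lbrace>D u, y\<rbrace> \<odot> \<lbrace>v, z\<rbrace> - D v \<odot> \<lbrace>y, \<lbrace>u, z\<rbrace>\<rbrace> + \<lbrace>D v, y\<rbrace> \<odot> \<lbrace>u, z\<rbrace>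
      + \<lbrace>y, D z\<rbrace> \<odot> \<lbrace>u, v\<rbrace> - D z \<odot> \<lbrace>\<lbrace>u, v\<rbrace>, y\<rbrace>"
    using bkt_skew [of y "D u"] bkt_skew [of y "D v"] bkt_skew [of y "\<lbrace>u, v\<rbrace>"]
    by (simp add: form expand leibniz algebra_simps)
  have 4: "nambu u v \<lbrace>y, z\<rbrace> =
      D u \<odot> \<lbrace>\<lbrace>v, y\<rbrace>, z\<rbrace> + D u \<odot> \<lbrace>y, \<lbrace>v, z\<rbrace>\<rbrace> - D v \<odot> \<lbrace>\<lbrace>u, y\<rbrace>, z\<rbrace> - D v \<odot> \<lbrace>y, \<lbrace>u, z\<rbrace>\<rbrace>
      + \<lbrace>D y, z\<rbrace> \<odot> \<lbrace>u, v\<rbrace> + \<lbrace>y, D z\<rbrace> \<odot> \<lbrace>u, v\<rbrace>"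
    by (simp add: form expand D_bkt jacobi_derivation [of v] jacobi_derivation [of u] algebra_simps)
  show ?thesis
    unfolding 1 2 3 4 by (simp add: algebra_simps)
qed

text \<open>
  The summand \<open>D x \<odot> \<lbrace>y, z\<rbrace>\<close> deviates from the product rule by a part \<open>?R\<close> from the
  commutator with \<open>D\<close> and a part \<open>?S\<close> from the bracket, the multiples of \<open>D \<lbrace>u, v\<rbrace>\<close> having
  cancelled. Over the cyclic sum, \<open>?R\<close> is a combination of Pluecker relations and the two terms
  of \<open>?S\<close> telescope.
\<close>

theorem nambu_derivation:
  "nambu u v (nambu x y z) =
    nambu (nambu u v x) y z + nambu x (nambu u v y) z + nambu x y (nambu u v z)"
proof -
  let ?d = "nambu u v"
  let ?R = "\<lambda>x. D (D u) \<odot> \<lbrace>v, x\<rbrace> - D (D v) \<odot> \<lbrace>u, x\<rbrace> + D u \<odot> \<lbrace>D v, x\<rbrace> - D v \<odot> \<lbrace>D u, x\<rbrace>"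
  let ?S = "\<lambda>y z. D y \<odot> \<lbrace>\<lbrace>u, v\<rbrace>, z\<rbrace> - D z \<odot> \<lbrace>\<lbrace>u, v\<rbrace>, y\<rbrace>"
  have one: "?d (D x \<odot> \<lbrace>y, z\<rbrace>) =
      D (?d x) \<odot> \<lbrace>y, z\<rbrace> + D x \<odot> \<lbrace>?d y, z\<rbrace> + D x \<odot> \<lbrace>y, ?d z\<rbrace>
      - ?R x \<odot> \<lbrace>y, z\<rbrace> - D x \<odot> ?S y z" for x y z
    by (simp add: nambu_prd D_nambu_commutator nambu_bkt_defect expand prd_assoc algebra_simps)
  let ?P = "\<lambda>h. \<lbrace>h, x\<rbrace> \<odot> \<lbrace>y, z\<rbrace> + \<lbrace>h, y\<rbrace> \<odot> \<lbrace>z, x\<rbrace> + \<lbrace>h, z\<rbrace> \<odot> \<lbrace>x, y\<rbrace>"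
  have "?R x \<odot> \<lbrace>y, z\<rbrace> + ?R y \<odot> \<lbrace>z, x\<rbrace> + ?R z \<odot> \<lbrace>x, y\<rbrace> =
      D (D u) \<odot> ?P v - D (D v) \<odot> ?P u + D u \<odot> ?P (D v) - D v \<odot> ?P (D u)"
    by (simp add: expand prd_assoc)
  then have R: "?R x \<odot> \<lbrace>y, z\<rbrace> + ?R y \<odot> \<lbrace>z, x\<rbrace> + ?R z \<odot> \<lbrace>x, y\<rbrace> = 0"
    by (simp add: pluecker_cyclic)
  have S: "D x \<odot> ?S y z + D y \<odot> ?S z x + D z \<odot> ?S x y = 0"
    by (simp add: expand prd.left_commute)
  show ?thesis
    unfolding nambu_def [of x y z] nambu_add one
      nambu_def [of "?d x"] nambu_def [of x "?d y"] nambu_def [of x y "?d z"]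
    using R S by (simp add: add_eq_0_iff algebra_simps)
qed

text \<open>
  In the determinant picture the next two sums expand a \<open>4 \<times> 4\<close> determinant along a row that
  depends linearly on the other three. For the row \<open>\<lbrace>h, -\<rbrace>\<close> the coefficient of each value of \<open>D\<close> is a
  Pluecker relation; for the row of values of \<open>D\<close> itself all terms cancel in pairs.
\<close>

lemma bkt_nambu_alternating_sum:
  "\<lbrace>h, u\<rbrace> \<odot> nambu z v w - \<lbrace>h, z\<rbrace> \<odot> nambu u v w
    + \<lbrace>h, w\<rbrace> \<odot> nambu z u v - \<lbrace>h, v\<rbrace> \<odot> nambu z u w = 0"
proof -
  let ?P = "\<lambda>a b c. \<lbrace>h, a\<rbrace> \<odot> \<lbrace>b, c\<rbrace> + \<lbrace>h, b\<rbrace> \<odot> \<lbrace>c, a\<rbrace> + \<lbrace>h, c\<rbrace> \<odot> \<lbrace>a, b\<rbrace>"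
  have "\<lbrace>h, u\<rbrace> \<odot> nambu z v w - \<lbrace>h, z\<rbrace> \<odot> nambu u v w
      + \<lbrace>h, w\<rbrace> \<odot> nambu z u v - \<lbrace>h, v\<rbrace> \<odot> nambu z u w
    = D z \<odot> ?P u v w - D u \<odot> ?P z v w + D v \<odot> ?P z u w - D w \<odot> ?P z u v"
    using bkt_skew [of u z] bkt_skew [of v z] bkt_skew [of w z]
      bkt_skew [of v u] bkt_skew [of w u] bkt_skew [of w v]
    by (simp add: nambu_def expand prd.left_commute)
  then show ?thesis
    by (simp add: pluecker_cyclic)
qed

lemma D_nambu_alternating_sum:
  "D u \<odot> nambu z v w - D z \<odot> nambu u v w + D w \<odot> nambu z u v - D v \<odot> nambu z u w = 0"
  using bkt_skew [of u z] bkt_skew [of v z] bkt_skew [of w z]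
    bkt_skew [of v u] bkt_skew [of w u] bkt_skew [of w v]
  by (simp add: nambu_def expand prd.left_commute)

text \<open>
  Expand the first factor of each product along the values of \<open>D\<close>: the coefficients of
  \<open>D x\<close>, \<open>D y\<close> and \<open>\<lbrace>x, y\<rbrace>\<close> are the alternating sums above.
\<close>

theorem nambu_pluecker:
  "nambu x y u \<odot> nambu z v w - nambu x y z \<odot> nambu u v w
    + nambu x y w \<odot> nambu z u v - nambu x y v \<odot> nambu z u w = 0"
proof -
  let ?B = "\<lambda>h. \<lbrace>h, u\<rbrace> \<odot> nambu z v w - \<lbrace>h, z\<rbrace> \<odot> nambu u v w
    + \<lbrace>h, w\<rbrace> \<odot> nambu z u v - \<lbrace>h, v\<rbrace> \<odot> nambu z u w"
  let ?C = "D u \<odot> nambu z v w - D z \<odot> nambu u v w + D w \<odot> nambu z u v - D v \<odot> nambu z u w"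
  have last: "nambu x y a = D x \<odot> \<lbrace>y, a\<rbrace> - D y \<odot> \<lbrace>x, a\<rbrace> + \<lbrace>x, y\<rbrace> \<odot> D a" for a
    using bkt_skew [of a x] by (simp add: nambu_def prd_commute)
  have "nambu x y u \<odot> nambu z v w - nambu x y z \<odot> nambu u v w
      + nambu x y w \<odot> nambu z u v - nambu x y v \<odot> nambu z u w
    = D x \<odot> ?B y - D y \<odot> ?B x + \<lbrace>x, y\<rbrace> \<odot> ?C"
    unfolding last [of u] last [of z] last [of v] last [of w]
    by (simp add: expand prd_assoc)
  then show ?thesis
    by (simp add: bkt_nambu_alternating_sum D_nambu_alternating_sum)
qed

end

section \<open>Untwisting\<close>

text \<open>
  For automorphisms \<open>\<alpha>\<close> and \<open>\<beta>\<close> of \<open>f\<close> this inverts the twist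
  \<open>f' x y = f (\<alpha> x) (\<beta> y)\<close> that turns ordinary structures into BiHom structures.
\<close>

definition untwist :: "('v \<Rightarrow> 'v) \<Rightarrow> ('v \<Rightarrow> 'v) \<Rightarrow> ('v \<Rightarrow> 'v \<Rightarrow> 'v) \<Rightarrow> 'v \<Rightarrow> 'v \<Rightarrow> 'v" where
  "untwist \<alpha> \<beta> f x y = f (inv \<alpha> x) (inv \<beta> y)"

lemma linear_map_iff:
  assumes "vector_space s"
  shows "Vector_Spaces.linear s s f \<longleftrightarrow>
    (\<forall>x y. f (x + y) = f x + f y) \<and> (\<forall>c x. f (s c x) = s c (f x))"
  using assms
  by (auto simp: Vector_Spaces.linear_iff)

locale strong_regular_bihom_poisson_derivation =
  regular_bihom_poisson_algebra scale mult br \<alpha> \<beta> + strong_bihom_poisson_algebra scale mult br \<alpha> \<beta>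
  for scale :: "'k::field_char_0 \<Rightarrow> 'v::ab_group_add \<Rightarrow> 'v"
    and mult :: "'v \<Rightarrow> 'v \<Rightarrow> 'v" (infixl "\<cdot>" 70)
    and br :: "'v \<Rightarrow> 'v \<Rightarrow> 'v"
    and \<alpha> \<beta> :: "'v \<Rightarrow> 'v" +
  fixes D :: "'v \<Rightarrow> 'v"
  assumes derivation_mult: "derivation scale (\<cdot>) D"
    and derivation_br: "derivation scale br D"
    and D_alpha: "D \<circ> \<alpha> = \<alpha> \<circ> D"
    and D_beta: "D \<circ> \<beta> = \<beta> \<circ> D"
begin

abbreviation prd (infixl "\<odot>" 70) where "prd \<equiv> untwist \<alpha> \<beta> (\<cdot>)"

abbreviation bkt ("\<lbrace>_, _\<rbrace>") where "bkt \<equiv> untwist \<alpha> \<beta> br"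

lemma alpha_inv [simp]: "\<alpha> (inv \<alpha> x) = x" "inv \<alpha> (\<alpha> x) = x"
  using bij_alpha by (simp_all add: bij_is_surj surj_f_inv_f bij_is_inj)

lemma beta_inv [simp]: "\<beta> (inv \<beta> x) = x" "inv \<beta> (\<beta> x) = x"
  using bij_beta by (simp_all add: bij_is_surj surj_f_inv_f bij_is_inj)

lemma twist_commute:
  "\<alpha> (\<beta> x) = \<beta> (\<alpha> x)" "\<alpha> (inv \<beta> x) = inv \<beta> (\<alpha> x)"
  "inv \<alpha> (\<beta> x) = \<beta> (inv \<alpha> x)" "inv \<alpha> (inv \<beta> x) = inv \<beta> (inv \<alpha> x)"
proof -
  show ab: "\<alpha> (\<beta> x) = \<beta> (\<alpha> x)" for x
    using fun_cong [OF alpha_beta_commute, of x] by simp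
  show ab': "\<alpha> (inv \<beta> x) = inv \<beta> (\<alpha> x)" for x
    by (metis ab beta_inv)
  show "inv \<alpha> (\<beta> x) = \<beta> (inv \<alpha> x)"
    by (metis ab alpha_inv)
  show "inv \<alpha> (inv \<beta> x) = inv \<beta> (inv \<alpha> x)"
    by (metis ab' alpha_inv)
qed

lemma D_commute:
  "D (\<alpha> x) = \<alpha> (D x)" "D (\<beta> x) = \<beta> (D x)"
  "D (inv \<alpha> x) = inv \<alpha> (D x)" "D (inv \<beta> x) = inv \<beta> (D x)"
proof -
  show a: "D (\<alpha> x) = \<alpha> (D x)" for x
    using fun_cong [OF D_alpha, of x] by simp
  show b: "D (\<beta> x) = \<beta> (D x)" for x
    using fun_cong [OF D_beta, of x] by simp
  show "D (inv \<alpha> x) = inv \<alpha> (D x)"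
    by (metis a alpha_inv)
  show "D (inv \<beta> x) = inv \<beta> (D x)"
    by (metis b beta_inv)
qed

lemma mult_eq_prd: "x \<cdot> y = \<alpha> x \<odot> \<beta> y"
  by (simp add: untwist_def)

lemma br_eq_bkt: "br x y = \<lbrace>\<alpha> x, \<beta> y\<rbrace>"
  by (simp add: untwist_def)

lemma twist_prd:
  "\<alpha> (x \<odot> y) = \<alpha> x \<odot> \<alpha> y" "\<beta> (x \<odot> y) = \<beta> x \<odot> \<beta> y"
  by (simp_all add: untwist_def alpha_mult beta_mult twist_commute)

lemma twist_bkt:
  "\<alpha> \<lbrace>x, y\<rbrace> = \<lbrace>\<alpha> x, \<alpha> y\<rbrace>" "\<beta> \<lbrace>x, y\<rbrace> = \<lbrace>\<beta> x, \<beta> y\<rbrace>"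
  by (simp_all add: untwist_def alpha_br beta_br twist_commute)

text \<open>
  As rewrite rules these replace the BiHom operations by the untwisted ones and move all
  twists inside the operations and outside \<open>D\<close>, in a fixed order with \<open>\<beta>\<close> outside \<open>\<alpha>\<close>, so that each twist meets its
  inverse and cancels.
\<close>

lemmas normalize = mult_eq_prd br_eq_bkt twist_prd twist_bkt twist_commute D_commute

lemma linear_props:
  "\<alpha> (x + y) = \<alpha> x + \<alpha> y" "\<alpha> (scale c x) = scale c (\<alpha> x)"
  "\<beta> (x + y) = \<beta> x + \<beta> y" "\<beta> (scale c x) = scale c (\<beta> x)"
  "D (x + y) = D x + D y" "D (scale c x) = scale c (D x)"
  using linear_alpha linear_beta derivation_mult
  unfolding derivation_def linear_map_iff [OF vector_space_axioms] by blast+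

lemma inv_linear:
  "inv \<alpha> (x + y) = inv \<alpha> x + inv \<alpha> y" "inv \<alpha> (scale c x) = scale c (inv \<alpha> x)"
  "inv \<beta> (x + y) = inv \<beta> x + inv \<beta> y" "inv \<beta> (scale c x) = scale c (inv \<beta> x)"
  using linear_props(1) [of "inv \<alpha> x" "inv \<alpha> y"] linear_props(2) [of c "inv \<alpha> x"]
    linear_props(3) [of "inv \<beta> x" "inv \<beta> y"] linear_props(4) [of c "inv \<beta> x"]
  by (metis alpha_inv beta_inv)+

lemma untwist_linear:
  "(x + y) \<odot> z = x \<odot> z + y \<odot> z" "scale c x \<odot> z = scale c (x \<odot> z)"
  "z \<odot> (x + y) = z \<odot> x + z \<odot> y" "z \<odot> scale c x = scale c (z \<odot> x)"
  "\<lbrace>x + y, z\<rbrace> = \<lbrace>x, z\<rbrace> + \<lbrace>y, z\<rbrace>" "\<lbrace>scale c x, z\<rbrace> = scale c \<lbrace>x, z\<rbrace>"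
  "\<lbrace>z, x + y\<rbrace> = \<lbrace>z, x\<rbrace> + \<lbrace>z, y\<rbrace>" "\<lbrace>z, scale c x\<rbrace> = scale c \<lbrace>z, x\<rbrace>"
  using mult_bilinear br_bilinear
  unfolding bilinear_map_def linear_map_iff [OF vector_space_axioms] untwist_def inv_linear by blast+

text \<open>
  Each ordinary axiom is the corresponding BiHom axiom at arguments to which exactly those inverse
  twists were applied that the BiHom axiom puts back.
\<close>

sublocale untwisted: strong_poisson_derivation prd bkt D
proof
  fix x y z h
  show "(x + y) \<odot> z = x \<odot> z + y \<odot> z" "\<lbrace>x + y, z\<rbrace> = \<lbrace>x, z\<rbrace> + \<lbrace>y, z\<rbrace>"
    by (simp_all add: untwist_linear)
  show "x \<odot> y = y \<odot> x"
    using bihom_comm [of "inv \<alpha> (inv \<beta> x)" "inv \<alpha> (inv \<beta> y)"] by (simp add: normalize)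
  show "(x \<odot> y) \<odot> z = x \<odot> (y \<odot> z)"
    using bihom_assoc [of "inv \<alpha> (inv \<alpha> x)" "inv \<alpha> (inv \<beta> y)" "inv \<beta> (inv \<beta> z)"]
    by (simp add: normalize)
  show "\<lbrace>x, y\<rbrace> = - \<lbrace>y, x\<rbrace>"
    using bihom_skew [of "inv \<alpha> (inv \<beta> x)" "inv \<alpha> (inv \<beta> y)"] by (simp add: normalize)
  let ?r = "\<lambda>x. inv \<alpha> (inv \<alpha> (inv \<beta> x))"
  show "\<lbrace>\<lbrace>x, y\<rbrace>, z\<rbrace> + \<lbrace>\<lbrace>y, z\<rbrace>, x\<rbrace> + \<lbrace>\<lbrace>z, x\<rbrace>, y\<rbrace> = 0"
    using bihom_jacobi [of "?r x" "?r y" "?r z"] by (simp add: normalize numeral_eq_Suc)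
  show "\<lbrace>x, y \<odot> z\<rbrace> = \<lbrace>x, y\<rbrace> \<odot> z + y \<odot> \<lbrace>x, z\<rbrace>"
    using bihom_leibniz [of "?r x" "inv \<alpha> (inv \<beta> y)" "inv \<beta> (inv \<beta> z)"]
    by (simp add: normalize)
  let ?s = "\<lambda>x. inv \<beta> (inv \<beta> (inv \<beta> (inv \<alpha> (inv \<alpha> (inv \<alpha> x)))))"
  show "\<lbrace>x, y\<rbrace> \<odot> \<lbrace>h, z\<rbrace> + \<lbrace>y, z\<rbrace> \<odot> \<lbrace>h, x\<rbrace> + \<lbrace>z, x\<rbrace> \<odot> \<lbrace>h, y\<rbrace> = 0"
    \<comment> \<open>\<open>h\<close> carries one \<open>\<beta>\<close> less than the other variables in the strong condition.\<close>
    using strong [of "?s x" "?s y" "\<beta> (?s h)" "?s z"] by (simp add: normalize numeral_eq_Suc)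
  show "D (x + y) = D x + D y"
    by (rule linear_props)
  show "D (x \<odot> y) = D x \<odot> y + x \<odot> D y"
    using derivation_mult by (simp add: derivation_def untwist_def D_commute)
  show "D \<lbrace>x, y\<rbrace> = \<lbrace>D x, y\<rbrace> + \<lbrace>x, D y\<rbrace>"
    using derivation_br by (simp add: derivation_def untwist_def D_commute)
qed

section \<open>The twisted ternary bracket\<close>

abbreviation tbr where "tbr \<equiv> ternary_bracket (\<cdot>) br \<alpha> \<beta> D"

lemma ternary_bracket_eq_nambu: "tbr x y z = untwisted.nambu (\<alpha> x) (\<alpha> y) (\<beta> z)"
  by (simp add: ternary_bracket_def untwisted.nambu_def normalize numeral_eq_Suc)

lemma twist_nambu:
  "\<alpha> (untwisted.nambu x y z) = untwisted.nambu (\<alpha> x) (\<alpha> y) (\<alpha> z)"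
  "\<beta> (untwisted.nambu x y z) = untwisted.nambu (\<beta> x) (\<beta> y) (\<beta> z)"
  by (simp_all add: untwisted.nambu_def linear_props normalize)

lemma trilinear_ternary_bracket: "trilinear_map scale tbr"
  unfolding trilinear_map_def linear_map_iff [OF vector_space_axioms] ternary_bracket_eq_nambu
    untwisted.nambu_def
  by (simp add: linear_props untwist_linear scale_right_distrib add.assoc add.left_commute)

text \<open>
  In every identity required of the ternary bracket each variable carries the same total twist
  in all terms once the twists have been moved inside, so the identity is an instance of the corresponding property of \<open>nambu\<close>.
\<close>

sublocale strong_bihom_poisson_three_lie_algebra scale mult tbr \<alpha> \<beta>
proof
  fix x y z u v w
  show "trilinear_map scale tbr"
    by (rule trilinear_ternary_bracket)
  show "\<alpha> (tbr x y z) = tbr (\<alpha> x) (\<alpha> y) (\<alpha> z)" "\<beta> (tbr x y z) = tbr (\<beta> x) (\<beta> y) (\<beta> z)"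
    by (simp_all add: ternary_bracket_eq_nambu twist_nambu twist_commute)
  show "tbr (\<beta> x) (\<beta> y) (\<alpha> z) = - tbr (\<beta> y) (\<beta> x) (\<alpha> z)"
    unfolding ternary_bracket_eq_nambu by (rule untwisted.nambu_swap_12)
  show "tbr (\<beta> x) (\<beta> y) (\<alpha> z) = - tbr (\<beta> x) (\<beta> z) (\<alpha> y)"
    unfolding ternary_bracket_eq_nambu twist_commute by (rule untwisted.nambu_swap_23)
  show "tbr (\<alpha> (\<beta> x)) (\<alpha> (\<beta> y)) (u \<cdot> v)
       = tbr (\<beta> x) (\<beta> y) u \<cdot> \<beta> v + \<beta> u \<cdot> tbr (\<alpha> x) (\<alpha> y) v"
    by (simp add: ternary_bracket_eq_nambu untwisted.nambu_prd twist_nambu normalize)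
  show "tbr ((\<beta> ^^ 2) u) ((\<beta> ^^ 2) v) (tbr (\<beta> x) (\<beta> y) (\<alpha> z))
         = tbr ((\<beta> ^^ 2) y) ((\<beta> ^^ 2) z) (tbr (\<beta> u) (\<beta> v) (\<alpha> x))
         - tbr ((\<beta> ^^ 2) x) ((\<beta> ^^ 2) z) (tbr (\<beta> u) (\<beta> v) (\<alpha> y))
         + tbr ((\<beta> ^^ 2) x) ((\<beta> ^^ 2) y) (tbr (\<beta> u) (\<beta> v) (\<alpha> z))"
  proof -
    have "untwisted.nambu u v (untwisted.nambu x y z) =
        untwisted.nambu y z (untwisted.nambu u v x) - untwisted.nambu x z (untwisted.nambu u v y)
        + untwisted.nambu x y (untwisted.nambu u v z)" for u v x y z
      using untwisted.nambu_derivation [of u v x y z]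
        untwisted.nambu_rotate [of "untwisted.nambu u v x" y z]
        untwisted.nambu_swap_23 [of x "untwisted.nambu u v y" z]
      by simp
    from this [of "\<alpha> (\<beta> (\<beta> u))" "\<alpha> (\<beta> (\<beta> v))"
        "\<alpha> (\<beta> (\<beta> x))" "\<alpha> (\<beta> (\<beta> y))" "\<alpha> (\<beta> (\<beta> z))"]
    show ?thesis
      by (simp add: ternary_bracket_eq_nambu twist_nambu twist_commute numeral_eq_Suc)
  qed
  show "0 = tbr ((\<beta> ^^ 2) x) ((\<beta> ^^ 2) y) (\<alpha> (\<beta> u)) \<cdot> tbr (\<alpha> (\<beta> z)) (\<alpha> (\<beta> v)) ((\<alpha> ^^ 2) w)
       - tbr ((\<beta> ^^ 2) x) ((\<beta> ^^ 2) y) (\<alpha> (\<beta> z)) \<cdot> tbr (\<alpha> (\<beta> u)) (\<alpha> (\<beta> v)) ((\<alpha> ^^ 2) w)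
       + tbr ((\<beta> ^^ 2) x) ((\<beta> ^^ 2) y) (\<alpha> (\<beta> w)) \<cdot> tbr (\<alpha> (\<beta> z)) (\<alpha> (\<beta> u)) ((\<alpha> ^^ 2) v)
       - tbr ((\<beta> ^^ 2) x) ((\<beta> ^^ 2) y) (\<alpha> (\<beta> v)) \<cdot> tbr (\<alpha> (\<beta> z)) (\<alpha> (\<beta> u)) ((\<alpha> ^^ 2) w)"
    by (simp add: ternary_bracket_eq_nambu twist_nambu normalize numeral_eq_Suc
        untwisted.nambu_pluecker)
qed

end

theorem theorem3p8:
  fixes scale :: "'k::field_char_0 \<Rightarrow> 'v::ab_group_add \<Rightarrow> 'v"
    and mult br :: "'v \<Rightarrow> 'v \<Rightarrow> 'v"
    and \<alpha> \<beta> D :: "'v \<Rightarrow> 'v"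
  assumes "regular_bihom_poisson_algebra scale mult br \<alpha> \<beta>"
    and "strong_bihom_poisson_algebra scale mult br \<alpha> \<beta>"
    and "derivation scale mult D"
    and "derivation scale br D"
    and "\<alpha> \<circ> \<beta> = \<beta> \<circ> \<alpha>" and "D \<circ> \<alpha> = \<alpha> \<circ> D" and "D \<circ> \<beta> = \<beta> \<circ> D"
  shows "strong_bihom_poisson_three_lie_algebra scale mult
           (ternary_bracket mult br \<alpha> \<beta> D) \<alpha> \<beta>"
proof -
  interpret strong_regular_bihom_poisson_derivation scale mult br \<alpha> \<beta> D
    using assms
    by (simp add: strong_regular_bihom_poisson_derivation_def
        strong_regular_bihom_poisson_derivation_axioms_def)
  show ?thesis
    by (rule strong_bihom_poisson_three_lie_algebra_axioms)
qed

end
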